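(* Let $\mathcal{T}$ be a canonical projection tiling in $\mathbb{R}^d$ arising from the lattice $\mathbb{Z}^N$, let $\{\mathbf{e}_j\}_{j=1}^N$ be the standard orthonormal basis of $\mathbb{R}^N$, and let $\mathbf{e}_j^*:=\pi(\mathbf{e}_j)\in\mathbb{R}^d$ be the projected basis vectors. Then for every vertex $v\in V$, $$v=\sum_{k=1}^N x_k(v)\,\mathbf{e}_k^*,$$ where $x_k(v)$ is the $k$-th lattice coordinate of $\Phi(v)$. In particular, $v$ is determined by the values of the $N$ integer height functions $h_k:=x_k\colon V\to\mathbb{Z}$.
   Context: Canonical projection tiling (CPT). Let $N>d\ge1$, $\Lambda=\mathbb{Z}^N\subset\mathbb{R}^N$, $E_\parallel\subset\mathbb{R}^N$ a $d$-dimensional subspace (physical space, identified with $\mathbb{R}^d$), $E_\perp=(E_\parallel)^\perp$, and $\pi\colon\mathbb{R}^N\to E_\parallel$, $\pi_\perp\colon\mathbb{R}^N\to E_\perp$ the complementary projections. It is required that: (irrationality) $\pi(\Lambda)$ is dense in $E_\parallel$; (injectivity) $\pi|_\Lambda$ is injective (in the paper: equivalently $\Lambda\cap E_\perp=\{\mathbf 0\}$); (generic window) the acceptance window $W\subset E_\perp$ is a compact polytope with $\partial W\cap\pi_\perp(\Lambda)=\varnothing$. The vertex set is $V=\{\pi(\mathbf{x}):\mathbf{x}\in\Lambda,\ \pi_\perp(\mathbf{x})\in W\}$, and the tiles are the images under $\pi$ of the Voronoi cells of $\Lambda$ whose $\pi_\perp$-projections intersect $W$. Lattice-coordinate map: for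 $v\in V$, $\Phi(v)=(x_1(v),\dots,x_N(v))\in\mathbb{Z}^N$ is the unique lattice point with $\pi(\Phi(v))=v$ and $\pi_\perp(\Phi(v))\in W$. *)

theory Defs
  imports "HOL-Analysis.Analysis"
begin

text \<open>The ambient space is \<open>real ^ 'n\<close>, with \<open>N = CARD('n)\<close>; the coordinates are indexed by the
  type \<open>'n\<close> instead of \<open>{1..N}\<close>.  Lattice coordinates are integers, so lattice points
  are kept as \<open>int ^ 'n\<close> together with the embedding \<open>lattice_pt\<close> into the ambient space.\<close>

definition lattice_pt :: "int ^ 'n \<Rightarrow> real ^ 'n::finite" where
  "lattice_pt z = (\<chi> i. real_of_int (z $ i))"

definition integer_lattice :: "(real ^ 'n::finite) set" where
  "integer_lattice = range lattice_pt"

text \<open>The physical space is the subspace \<open>E\<close> itself, and \<open>E\<^sup>\<bottom>\<close> is the perpendicular space.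
  The values of \<open>proj_par E\<close> and \<open>proj_perp E\<close> are the two components of a vector in the
  decomposition of the ambient space into \<open>E\<close> and \<open>E\<^sup>\<bottom>\<close>.\<close>

definition proj_par :: "(real ^ 'n::finite) set \<Rightarrow> real ^ 'n \<Rightarrow> real ^ 'n" where
  "proj_par E x = (THE p. p \<in> E \<and> x - p \<in> E\<^sup>\<bottom>)"

definition proj_perp :: "(real ^ 'n::finite) set \<Rightarrow> real ^ 'n \<Rightarrow> real ^ 'n" where
  "proj_perp E x = (THE q. q \<in> E\<^sup>\<bottom> \<and> x - q \<in> E)"

definition voronoi_cell :: "'a::metric_space set \<Rightarrow> 'a \<Rightarrow> 'a set" where
  "voronoi_cell L p = {y. \<forall>q\<in>L. dist y p \<le> dist y q}"

definition cpt_tiles :: "(real ^ 'n::finite) set \<Rightarrow> (real ^ 'n) set \<Rightarrow> (real ^ 'n) set set" where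
  "cpt_tiles E W =
     {proj_par E ` C | C. C \<in> voronoi_cell integer_lattice ` integer_lattice \<and>
                          proj_perp E ` C \<inter> W \<noteq> {}}"

definition cpt_vertices :: "(real ^ 'n::finite) set \<Rightarrow> (real ^ 'n) set \<Rightarrow> (real ^ 'n) set" where
  "cpt_vertices E W = {proj_par E x | x. x \<in> integer_lattice \<and> proj_perp E x \<in> W}"

text \<open>\<open>T\<close> is the set of tiles of the canonical projection tiling with physical space \<open>E\<close> of
  dimension \<open>d\<close> and acceptance window \<open>W\<close>.  The boundary of \<open>W\<close> is taken in the
  subspace topology of \<open>E\<^sup>\<bottom>\<close>; compactness of \<open>W\<close> is implied by \<open>polytope W\<close>.\<close>

definition canonical_projection_tiling ::
  "nat \<Rightarrow> (real ^ 'n::finite) set \<Rightarrow> (real ^ 'n) set \<Rightarrow> (real ^ 'n) set set \<Rightarrow> bool" where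
  "canonical_projection_tiling d E W T \<longleftrightarrow>
     1 \<le> d \<and> d < CARD('n) \<and>
     subspace E \<and> dim E = d \<and>
     E \<subseteq> closure (proj_par E ` integer_lattice) \<and>
     inj_on (proj_par E) integer_lattice \<and>
     W \<subseteq> E\<^sup>\<bottom> \<and> polytope W \<and>
     ((top_of_set (E\<^sup>\<bottom>)) frontier_of W) \<inter> proj_perp E ` integer_lattice = {} \<and>
     T = cpt_tiles E W"

definition lattice_coords ::
  "(real ^ 'n::finite) set \<Rightarrow> (real ^ 'n) set \<Rightarrow> real ^ 'n \<Rightarrow> int ^ 'n" where
  "lattice_coords E W v =
     (THE z. proj_par E (lattice_pt z) = v \<and> proj_perp E (lattice_pt z) \<in> W)"

definition height ::
  "(real ^ 'n::finite) set \<Rightarrow> (real ^ 'n) set \<Rightarrow> 'n \<Rightarrow> real ^ 'n \<Rightarrow> int" where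
  "height E W k v = lattice_coords E W v $ k"

definition proj_basis :: "(real ^ 'n::finite) set \<Rightarrow> 'n \<Rightarrow> real ^ 'n" where
  "proj_basis E k = proj_par E (axis k 1)"

text \<open>The definite descriptions above are well defined.\<close>

lemma ex1_proj_par:
  fixes E :: "(real ^ 'n::finite) set"
  assumes E: "subspace E"
  shows "\<exists>!p. p \<in> E \<and> x - p \<in> E\<^sup>\<bottom>"
proof (rule ex_ex1I)
  obtain y z where "y \<in> span E" "\<And>w. w \<in> span E \<Longrightarrow> orthogonal z w" "x = y + z"
    using orthogonal_subspace_decomp_exists[of E x] by metis
  then show "\<exists>p. p \<in> E \<and> x - p \<in> E\<^sup>\<bottom>"
    using E by (intro exI[of _ y])
      (auto simp: orthogonal_comp_def orthogonal_commute span_eq_iff[THEN iffD2])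
next
  fix p q
  assume p: "p \<in> E \<and> x - p \<in> E\<^sup>\<bottom>" and q: "q \<in> E \<and> x - q \<in> E\<^sup>\<bottom>"
  then have "p - q \<in> E" using E by (simp add: subspace_diff)
  then have "(p - q) \<bullet> (x - p) = 0" "(p - q) \<bullet> (x - q) = 0"
    using p q by (auto simp: orthogonal_comp_def orthogonal_def)
  then have "(p - q) \<bullet> (p - q) = 0" by (simp add: inner_diff_right)
  then show "p = q" by simp
qed

lemma ex1_proj_perp:
  fixes E :: "(real ^ 'n::finite) set"
  assumes "subspace E"
  shows "\<exists>!q. q \<in> E\<^sup>\<bottom> \<and> x - q \<in> E"
  using ex1_proj_par[OF subspace_orthogonal_comp[of E], of x]
  by (simp add: orthogonal_comp_self assms)

lemma ex1_lattice_coords: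
  assumes "canonical_projection_tiling d E W T" and "v \<in> cpt_vertices E W"
  shows "\<exists>!z. proj_par E (lattice_pt z) = v \<and> proj_perp E (lattice_pt z) \<in> W"
proof (rule ex_ex1I)
  show "\<exists>z. proj_par E (lattice_pt z) = v \<and> proj_perp E (lattice_pt z) \<in> W"
    using assms(2) unfolding cpt_vertices_def integer_lattice_def by auto
next
  fix z z'
  assume "proj_par E (lattice_pt z) = v \<and> proj_perp E (lattice_pt z) \<in> W"
    and "proj_par E (lattice_pt z') = v \<and> proj_perp E (lattice_pt z') \<in> W"
  moreover have "inj_on (proj_par E) integer_lattice"
    using assms(1) by (simp add: canonical_projection_tiling_def)
  ultimately have "lattice_pt z = lattice_pt z'"
    by (metis inj_onD integer_lattice_def rangeI)
  then show "z = z'" by (simp add: lattice_pt_def vec_eq_iff)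
qed

end

theory Submission
  imports Defs
begin

text \<open>A lattice point is the integer combination of the standard basis vectors whose coefficients
  are its own coordinates. The projection onto the physical space is linear, so it carries this
  expansion of the point \<open>\<Phi>(v)\<close> to an expansion of its image \<open>v\<close> in the projected basis, with the
  same coefficients, the heights of \<open>v\<close>. There are more projected vectors
  than the dimension of the physical space, so they are linearly dependent over the reals, and the
  heights are well defined because the projection is injective on the lattice, which makes
  \<open>\<Phi>(v)\<close> unique (\<open>ex1_lattice_coords\<close>). The right-hand side of the
  expansion depends on \<open>v\<close> through the heights only, and so the heights separate vertices.\<close>

lemma proj_par_decomp:
  assumes "subspace E"
  shows "proj_par E x \<in> E" "x - proj_par E x \<in> E\<^sup>\<bottom>"
  using theI'[OF ex1_proj_par[OF assms, of x]] by (simp_all add: proj_par_def)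

lemma proj_par_eqI:
  assumes "subspace E" "p \<in> E" "x - p \<in> E\<^sup>\<bottom>"
  shows "proj_par E x = p"
  using ex1_proj_par[OF assms(1), of x] proj_par_decomp[OF assms(1), of x] assms(2,3) by blast

text \<open>Both \<open>E\<close> and \<open>E\<^sup>\<bottom>\<close> are closed under linear combinations, so the same combination of two
  orthogonal decompositions is again one, and decompositions are unique.\<close>

lemma linear_proj_par:
  fixes E :: "(real ^ 'n::finite) set"
  assumes E: "subspace E"
  shows "linear (proj_par E)"
proof (rule linearI)
  note decomp = proj_par_decomp[OF E]
  note perp = subspace_orthogonal_comp[of E]
  fix x y :: "real ^ 'n" and c :: real
  have "(x + y) - (proj_par E x + proj_par E y) = (x - proj_par E x) + (y - proj_par E y)"
    by simp
  then show "proj_par E (x + y) = proj_par E x + proj_par E y"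
    by (metis proj_par_eqI[OF E] decomp subspace_add[OF E] subspace_add[OF perp])
  have "c *\<^sub>R x - c *\<^sub>R proj_par E x = c *\<^sub>R (x - proj_par E x)"
    by (simp add: scaleR_diff_right)
  then show "proj_par E (c *\<^sub>R x) = c *\<^sub>R proj_par E x"
    by (metis proj_par_eqI[OF E] decomp subspace_scale[OF E] subspace_scale[OF perp])
qed

lemma lattice_pt_expansion:
  "lattice_pt z = (\<Sum>k\<in>UNIV. real_of_int (z $ k) *\<^sub>R axis k 1)"
  by (subst basis_expansion[symmetric]) (simp add: lattice_pt_def scalar_mult_eq_scaleR)

lemma proj_par_lattice_pt:
  assumes "subspace E"
  shows "proj_par E (lattice_pt z) = (\<Sum>k\<in>UNIV. real_of_int (z $ k) *\<^sub>R proj_basis E k)"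
  unfolding lattice_pt_expansion proj_basis_def
  by (simp add: linear_sum[OF linear_proj_par[OF assms]]
      linear_scale[OF linear_proj_par[OF assms]])

lemma proj_par_lattice_coords:
  assumes "canonical_projection_tiling d E W T" "v \<in> cpt_vertices E W"
  shows "proj_par E (lattice_pt (lattice_coords E W v)) = v"
  using theI'[OF ex1_lattice_coords[OF assms]] by (simp add: lattice_coords_def)

theorem proposition2p13:
  fixes E W :: "(real ^ 'n::finite) set"
    and T :: "(real ^ 'n) set set"
    and d :: nat
  assumes "canonical_projection_tiling d E W T"
  shows "(\<forall>v\<in>cpt_vertices E W.
            v = (\<Sum>k\<in>UNIV. real_of_int (height E W k v) *\<^sub>R proj_basis E k)) \<and>
         (\<forall>v\<in>cpt_vertices E W. \<forall>w\<in>cpt_vertices E W.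
            (\<forall>k. height E W k v = height E W k w) \<longrightarrow> v = w)"
proof -
  have E: "subspace E"
    using assms by (simp add: canonical_projection_tiling_def)
  have expansion: "v = (\<Sum>k\<in>UNIV. real_of_int (height E W k v) *\<^sub>R proj_basis E k)"
    if "v \<in> cpt_vertices E W" for v
    using proj_par_lattice_coords[OF assms that]
      proj_par_lattice_pt[OF E, of "lattice_coords E W v"]
    by (simp add: height_def)
  moreover have "v = w"
    if "v \<in> cpt_vertices E W" "w \<in> cpt_vertices E W" "\<forall>k. height E W k v = height E W k w"
    for v w
    using expansion[OF that(1)] expansion[OF that(2)] that(3) by simp
  ultimately show ?thesis by blast
qed

end
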